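(* Let $n$ be even and let $G$ be a graph on vertex set $[n]\times[n]$ all of whose edges go between $J_1=[n/2]^2$ and $J_2=\{n/2+1,\dots,n\}^2$. Then $G$ is a Yes-instance of $(n\times n)$-BPIS if and only if the partial function $\gamma_G$ is computed by some once-appearance branching program (oaBP).
   Context: $(n\times n)$-BPIS: for $n$ even, an instance is a graph $G$ on $[n]\times[n]$ whose edges all lie between $J_1=[n/2]^2$ and $J_2=\{n/2+1,\dots,n\}^2$; $G$ is a Yes-instance iff there is an independent set $S\subseteq J_1\cup J_2$ of size $n$ such that for every $i\in[n]$ there are $j,k$ with $(i,j)\in S$ and $(k,i)\in S$ (i.e. $S$ is the graph of a permutation of $[n]$). For $i\in[m]$ let $e_i\in\{0,1\}^m$ be the vector with a $1$ in coordinate $i$ and $0$ elsewhere (dimension clear from context), and for $e_i\in\{0,1\}^{n/2}$ let $\overline{e_i}=1^{n/2}-e_i$. Write inputs as $(\vec x,\vec y,\vec z)\in(\{0,1\}^n)^3$. The partial function $\gamma_G:\{0,1\}^{3n}\to\{0,1,*\}$ takes the value given by the first of the following conditions that holds: (1) if $\vec x=0^n$: $\bigvee_{i\in[n]}(y_i\land z_i)$; (2) if $\vec x=1^n$: $\bigvee_i z_i$; (3) if $\vec z=1^n$: $\bigvee_i(x_i\lor y_i)$; (4) if $\vec z=0^n$: $0$; (5) if $\vec z=1^{n/2}0^{n/2}$ and $\vec y=0^n$: $\bigvee_{i=1}^{n/2}x_i$; (6) if $\vec z=0^{n/2}1^{n/2}$ and $\vec y=0^n$: $\bigvee_{i=n/2+1}^{n}x_i$;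 (7) if there is an edge between $(j,k)\in[n/2]^2$ and $(n/2+j',n/2+k')$ in $G$ (with $j,k,j',k'\in[n/2]$) such that $(\vec x,\vec y,\vec z)=(\overline{e_k}\,\overline{e_{k'}},0^n,e_je_{j'})$ (concatenations of two $n/2$-bit vectors): $1$; (8) otherwise $*$. A branching program (BP) on Boolean variables is a directed acyclic graph with one source and two sinks labeled $0$ and $1$; each non-sink node is labeled by a variable and has two outgoing edges labeled $0$ and $1$; it computes by following, from the source, the edge labeled with the current node's variable value until a sink is reached. A once-appearance branching program (oaBP) is a BP whose non-sink node labels are pairwise distinct. A BP computes a partial function if its output agrees with the function on every input where the function is not $*$.
   Formalization: The formal theorem assumes n ≥ 4: for n = 2 the input in clause (7) is already covered by clause (1), so γ_G does not depend on G and the equivalence fails for the graph with edge (1,1)–(2,2); for n = 0 no branching program with a single source exists. *)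

theory Defs imports Main begin

definition J1 :: "nat \<Rightarrow> (nat \<times> nat) set" where
  "J1 n = {1..n div 2} \<times> {1..n div 2}"

definition J2 :: "nat \<Rightarrow> (nat \<times> nat) set" where
  "J2 n = {n div 2 + 1..n} \<times> {n div 2 + 1..n}"

text \<open>A simple undirected graph on the fixed vertex set \<open>{1..n} \<times> {1..n}\<close> is given by its set of
  edges, each edge being the two-element set of its endpoints.\<close>

definition bpis_graph :: "nat \<Rightarrow> (nat \<times> nat) set set \<Rightarrow> bool" where
  "bpis_graph n E \<longleftrightarrow> (\<forall>e\<in>E. \<exists>u\<in>J1 n. \<exists>v\<in>J2 n. e = {u, v})"

definition independent_set :: "'a set set \<Rightarrow> 'a set \<Rightarrow> bool" where
  "independent_set E S \<longleftrightarrow> (\<forall>u\<in>S. \<forall>v\<in>S. {u, v} \<notin> E)"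

definition bpis_yes :: "nat \<Rightarrow> (nat \<times> nat) set set \<Rightarrow> bool" where
  "bpis_yes n E \<longleftrightarrow> (\<exists>S. S \<subseteq> J1 n \<union> J2 n \<and> independent_set E S \<and> card S = n \<and>
     (\<forall>i\<in>{1..n}. (\<exists>j. (i, j) \<in> S) \<and> (\<exists>k. (k, i) \<in> S)))"

text \<open>A vector in \<open>{0,1}\<^sup>m\<close> is a function \<open>nat \<Rightarrow> bool\<close> of which only the coordinates
  \<open>1, \<dots>, m\<close> matter; equality of such vectors is \<open>vec_eq m\<close>.\<close>

type_synonym bvec = "nat \<Rightarrow> bool"

definition vec_eq :: "nat \<Rightarrow> bvec \<Rightarrow> bvec \<Rightarrow> bool" where
  "vec_eq m u v \<longleftrightarrow> (\<forall>i\<in>{1..m}. u i = v i)"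

definition const_vec :: "bool \<Rightarrow> bvec" where
  "const_vec b = (\<lambda>_. b)"

definition unit_vec :: "nat \<Rightarrow> bvec" where
  "unit_vec i = (\<lambda>l. l = i)"

definition compl_vec :: "bvec \<Rightarrow> bvec" where
  "compl_vec u = (\<lambda>l. \<not> u l)"

definition concat_vec :: "nat \<Rightarrow> bvec \<Rightarrow> bvec \<Rightarrow> bvec" where
  "concat_vec h u v = (\<lambda>l. if l \<le> h then u l else v (l - h))"

text \<open>The value \<open>None\<close> stands for \<open>*\<close>.\<close>

definition gamma ::
  "nat \<Rightarrow> (nat \<times> nat) set set \<Rightarrow> bvec \<Rightarrow> bvec \<Rightarrow> bvec \<Rightarrow> bool option" where
  "gamma n E x y z = (let h = n div 2 in
     if vec_eq n x (const_vec False) then Some (\<exists>i\<in>{1..n}. y i \<and> z i)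
     else if vec_eq n x (const_vec True) then Some (\<exists>i\<in>{1..n}. z i)
     else if vec_eq n z (const_vec True) then Some (\<exists>i\<in>{1..n}. x i \<or> y i)
     else if vec_eq n z (const_vec False) then Some False
     else if vec_eq n z (concat_vec h (const_vec True) (const_vec False)) \<and>
             vec_eq n y (const_vec False)
       then Some (\<exists>i\<in>{1..h}. x i)
     else if vec_eq n z (concat_vec h (const_vec False) (const_vec True)) \<and>
             vec_eq n y (const_vec False)
       then Some (\<exists>i\<in>{h+1..n}. x i)
     else if (\<exists>j\<in>{1..h}. \<exists>k\<in>{1..h}. \<exists>j'\<in>{1..h}. \<exists>k'\<in>{1..h}.
                {(j, k), (h + j', h + k')} \<in> E \<and>
                vec_eq n x (concat_vec h (compl_vec (unit_vec k)) (compl_vec (unit_vec k'))) \<and>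
                vec_eq n y (const_vec False) \<and>
                vec_eq n z (concat_vec h (unit_vec j) (unit_vec j')))
       then Some True
     else None)"

datatype gvar = XVar nat | YVar nat | ZVar nat

definition gamma_vars :: "nat \<Rightarrow> gvar set" where
  "gamma_vars n = XVar ` {1..n} \<union> YVar ` {1..n} \<union> ZVar ` {1..n}"

definition gamma_fun :: "nat \<Rightarrow> (nat \<times> nat) set set \<Rightarrow> (gvar \<Rightarrow> bool) \<Rightarrow> bool option" where
  "gamma_fun n E a = gamma n E (\<lambda>i. a (XVar i)) (\<lambda>i. a (YVar i)) (\<lambda>i. a (ZVar i))"

text \<open>\<open>sink B b\<close> is the sink labeled \<open>b\<close>, and \<open>succ B u b\<close> is the head of the edge labeled \<open>b\<close>
  leaving the non-sink node \<open>u\<close>; the two edges leaving a node may have the same head. Nodes are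
  natural numbers, which is no restriction since branching programs are finite.\<close>

record 'v bp =
  nodes :: "nat set"
  source :: nat
  sink :: "bool \<Rightarrow> nat"
  label :: "nat \<Rightarrow> 'v"
  succ :: "nat \<Rightarrow> bool \<Rightarrow> nat"

definition inner_nodes :: "'v bp \<Rightarrow> nat set" where
  "inner_nodes B = nodes B - range (sink B)"

definition bp_edges :: "'v bp \<Rightarrow> (nat \<times> nat) set" where
  "bp_edges B = {(u, succ B u b) | u b. u \<in> inner_nodes B}"

definition is_bp :: "'v set \<Rightarrow> 'v bp \<Rightarrow> bool" where
  "is_bp V B \<longleftrightarrow>
     finite (nodes B) \<and>
     range (sink B) \<subseteq> nodes B \<and> sink B False \<noteq> sink B True \<and>
     (\<forall>u\<in>inner_nodes B. label B u \<in> V \<and> (\<forall>b. succ B u b \<in> nodes B)) \<and>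
     acyclic (bp_edges B) \<and>
     {v \<in> nodes B. \<forall>u. (u, v) \<notin> bp_edges B} = {source B}"

definition is_oabp :: "'v set \<Rightarrow> 'v bp \<Rightarrow> bool" where
  "is_oabp V B \<longleftrightarrow> is_bp V B \<and> inj_on (label B) (inner_nodes B)"

definition bp_step :: "'v bp \<Rightarrow> ('v \<Rightarrow> bool) \<Rightarrow> (nat \<times> nat) set" where
  "bp_step B a = {(u, succ B u (a (label B u))) | u. u \<in> inner_nodes B}"

definition bp_outputs :: "'v bp \<Rightarrow> ('v \<Rightarrow> bool) \<Rightarrow> bool \<Rightarrow> bool" where
  "bp_outputs B a b \<longleftrightarrow> (source B, sink B b) \<in> (bp_step B a)\<^sup>*"

definition bp_computes :: "'v bp \<Rightarrow> (('v \<Rightarrow> bool) \<Rightarrow> bool option) \<Rightarrow> bool" where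
  "bp_computes B f \<longleftrightarrow> (\<forall>a b. f a = Some b \<longrightarrow> bp_outputs B a b)"

text \<open>The case \<open>n = 2\<close> is degenerate: there the only possible edge joins \<open>(1,1)\<close> and \<open>(2,2)\<close>, the
  input \<open>x = 00\<close>, \<open>y = 00\<close>, \<open>z = 11\<close> it contributes in the seventh clause is already claimed by the
  first one, and so \<open>gamma 2\<close> does not depend on the graph, whereas being a Yes-instance does.
  Hence the equivalence between Yes-instances and computability of \<open>gamma\<close> fails for \<open>n = 2\<close>. (For
  \<open>n = 0\<close> there are no variables, hence no branching program with exactly one source.)\<close>

lemma gamma_2_graph_irrelevant: "gamma 2 E = gamma 2 E'"
proof -
  have zero: "vec_eq 2 x (const_vec False)"
    if "vec_eq 2 x (concat_vec 1 (compl_vec (unit_vec k)) (compl_vec (unit_vec k')))"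
      "k \<in> {1..1}" "k' \<in> {1..1}" for x k k'
    using that
    by (auto simp: vec_eq_def concat_vec_def compl_vec_def unit_vec_def const_vec_def)
  have h: "2 div 2 = (1::nat)" by simp
  have empty: "gamma 2 F x y z = gamma 2 {} x y z" for F x y z
  proof (cases "vec_eq 2 x (const_vec False)")
    case True
    then show ?thesis unfolding gamma_def Let_def by (simp only: if_True)
  next
    case False
    have no_edge: "(\<exists>j\<in>{1..1}. \<exists>k\<in>{1..1}. \<exists>j'\<in>{1..1}. \<exists>k'\<in>{1..1}.
        {(j, k), (1 + j', 1 + k')} \<in> F' \<and>
        vec_eq 2 x (concat_vec 1 (compl_vec (unit_vec k)) (compl_vec (unit_vec k'))) \<and>
        vec_eq 2 y (const_vec False) \<and>
        vec_eq 2 z (concat_vec 1 (unit_vec j) (unit_vec j'))) = False" for F' :: "(nat \<times> nat) set set"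
      using False zero by blast
    show ?thesis unfolding gamma_def Let_def h no_edge by (rule refl)
  qed
  have "gamma 2 E x y z = gamma 2 E' x y z" for x y z
    using empty[of E x y z] empty[of E' x y z] by (rule trans[OF _ sym])
  then show ?thesis by (intro ext)
qed

lemma J_2: "J1 2 = {(1, 1)}" "J2 2 = {(2, 2)}"
  by (auto simp: J1_def J2_def)

lemma bpis_graph_2: "bpis_graph 2 {}" "bpis_graph 2 {{(1, 1), (2, 2)}}"
  by (simp_all add: bpis_graph_def J_2)

lemma bpis_yes_2: "bpis_yes 2 {}" "\<not> bpis_yes 2 {{(1, 1), (2, 2)}}"
proof -
  have "i = 1 \<or> i = 2" if "i \<in> {1..2}" for i :: nat using that by auto
  then show "bpis_yes 2 {}"
    unfolding bpis_yes_def
    by (intro exI[of _ "{(1, 1), (2, 2)}"]) (fastforce simp: J_2 independent_set_def)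
  show "\<not> bpis_yes 2 {{(1, 1), (2, 2)}}"
  proof
    assume "bpis_yes 2 {{(1, 1), (2, 2)}}"
    then obtain S where S: "S \<subseteq> J1 2 \<union> J2 2" "independent_set {{(1, 1), (2, 2)}} S"
      and ex: "\<forall>i\<in>{1..2}. \<exists>j. (i, j) \<in> S"
      unfolding bpis_yes_def by auto
    have "(1, 1) \<in> S" using ex[rule_format, of 1] S(1) unfolding J_2 by auto
    moreover have "(2, 2) \<in> S" using ex[rule_format, of 2] S(1) unfolding J_2 by auto
    ultimately show False using S(2) by (auto simp: independent_set_def)
  qed
qed

end

theory Submission imports Defs begin

text \<open>A permutation \<open>\<pi>\<close> whose graph is independent turns \<open>\<gamma>\<^sub>G\<close> into a restriction of the read-once
  formula \<open>\<Or>\<^sub>i z\<^sub>i \<and> (x\<^bsub>\<pi> i\<^esub> \<or> y\<^sub>i)\<close>, which has a once-appearance branching program.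

  Conversely, let \<open>P\<close> be the computation path on the input \<open>(0\<^sup>n, 0\<^sup>n, 1\<^sup>n)\<close> of a program for \<open>\<gamma>\<^sub>G\<close>. By
  sensitivity it reads all \<open>x\<^sub>i\<close> and \<open>y\<^sub>i\<close>. The \<open>1\<close>-edge of each \<open>x\<^sub>k\<close> leaves \<open>P\<close>, either to a node reading
  some \<open>z\<^sub>j\<close> off \<open>P\<close>, whose \<open>1\<close>-edge leads to the sink \<open>1\<close>, or to that sink itself; in the latter case
  \<open>x\<^sub>k\<close> lies in a stretch of \<open>P\<close> which the \<open>0\<close>-edge of some \<open>z\<^sub>j\<close> on \<open>P\<close> jumps over and which is entered only
  through \<open>z\<^sub>j = 1\<close>. With \<open>\<sigma> k = j\<close>, the program can thus accept an input with \<open>y = 0\<^sup>n\<close> only if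
  \<open>x\<^sub>k = z\<^bsub>\<sigma> k\<^esub> = 1\<close> for some \<open>k\<close>. The clauses (2), (5) and (6) of \<open>\<gamma>\<^sub>G\<close> then make \<open>\<sigma>\<close> a permutation
  that respects the two halves, and clause (7) makes the set of all \<open>(\<sigma> k, k)\<close> independent.\<close>

section \<open>Read-once programs as ranked transition systems\<close>

datatype 'v state = Var 'v | Out bool

text \<open>Distinct labels allow a node to be named by the variable it reads, so the
  once-appearance property is built into the type of states. Acyclicity becomes a decreasing
  \<open>rank\<close>; a higher rank means being read earlier.\<close>

locale once_program =
  fixes nxt :: "'v \<Rightarrow> bool \<Rightarrow> 'v state"
    and rank :: "'v state \<Rightarrow> nat"
  assumes rank_nxt: "rank (nxt v b) < rank (Var v)"
begin

inductive step :: "('v \<Rightarrow> bool) \<Rightarrow> 'v state \<Rightarrow> 'v state \<Rightarrow> bool" for a where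
  "step a (Var v) (nxt v (a v))"

inductive_cases stepE: "step a s t"

abbreviation visits :: "('v \<Rightarrow> bool) \<Rightarrow> 'v state \<Rightarrow> 'v state \<Rightarrow> bool" where
  "visits a \<equiv> (step a)\<^sup>*\<^sup>*"

definition out :: "('v \<Rightarrow> bool) \<Rightarrow> 'v state \<Rightarrow> bool" where
  "out a s \<longleftrightarrow> visits a s (Out True)"

lemma step_rank: "step a s t \<Longrightarrow> rank t < rank s"
  by (auto elim!: stepE simp: rank_nxt)

lemma visits_rank_less: "visits a s t \<Longrightarrow> s \<noteq> t \<Longrightarrow> rank t < rank s"
  by (induction rule: rtranclp_induct) (auto dest!: step_rank intro: less_trans)

lemma visits_rank: "visits a s t \<Longrightarrow> rank t \<le> rank s"
  using visits_rank_less[of a s t] by (cases "s = t") auto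

lemma visits_Var: "visits a (Var v) t \<longleftrightarrow> t = Var v \<or> visits a (nxt v (a v)) t"
proof
  assume "visits a (Var v) t"
  then show "t = Var v \<or> visits a (nxt v (a v)) t"
    by (cases rule: converse_rtranclpE) (auto elim: stepE)
qed (auto intro: converse_rtranclp_into_rtranclp step.intros)

lemma visits_Out: "visits a (Out b) t \<longleftrightarrow> t = Out b"
proof
  assume "visits a (Out b) t"
  then show "t = Out b" by (cases rule: converse_rtranclpE) (auto elim: stepE)
qed simp

lemma visits_nxt: "visits a s (Var v) \<Longrightarrow> visits a s (nxt v (a v))"
  by (metis rtranclp.rtrancl_into_rtrancl step.intros)

lemma visits_linear: "visits a s t \<Longrightarrow> visits a s t' \<Longrightarrow> visits a t t' \<or> visits a t' t"
proof (induction rule: rtranclp_induct)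
  case base
  then show ?case by simp
next
  case (step t u)
  from step.hyps(2) obtain v where "t = Var v" "u = nxt v (a v)" by (auto elim: stepE)
  with step show ?case by (auto simp: visits_Var intro: visits_nxt)
qed

lemma visits_later:
  assumes "visits a s t" "visits a s t'" "rank t' \<le> rank t" shows "visits a t t'"
proof (cases "t = t'")
  case False
  then have "\<not> visits a t' t" using visits_rank_less[of a t' t] assms(3) by auto
  then show ?thesis using visits_linear[OF assms(1,2)] by blast
qed simp

lemma out_Out [simp]: "out a (Out b) = b"
  by (auto simp: out_def visits_Out)

lemma out_Var: "out a (Var v) = out a (nxt v (a v))"
  by (auto simp: out_def visits_Var)

lemma out_visits: "visits a s t \<Longrightarrow> out a s = out a t"
  by (induction rule: rtranclp_induct) (auto elim!: stepE simp: out_Var)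

lemma state_rank_induct [case_names Out Var]:
  assumes "\<And>b. Q (Out b)" "\<And>v. (\<And>b. Q (nxt v b)) \<Longrightarrow> Q (Var v)"
  shows "Q s"
proof (induction "rank s" arbitrary: s rule: less_induct)
  case less
  then show ?case using assms rank_nxt by (cases s) auto
qed

lemma visits_Out_out: "visits a s (Out (out a s))"
  by (induction s rule: state_rank_induct) (auto simp: visits_Var out_Var)

text \<open>The way to \<open>t\<close> reads only variables of rank above \<open>t\<close>.
  Together with \<open>out_cong\<close>, which concerns the variables from \<open>s\<close>
  downwards, this permits changing an input separately before and after a state.\<close>

lemma visits_cong:
  assumes "visits a s t" "\<And>v. rank t < rank (Var v) \<Longrightarrow> a v = a' v"
  shows "visits a' s t"
  using assms
proof (induction rule: converse_rtranclp_induct)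
  case base
  then show ?case by simp
next
  case (step s u)
  then obtain v where v: "s = Var v" "u = nxt v (a v)" by (auto elim: stepE)
  have "rank t < rank (Var v)"
    using visits_rank[OF step.hyps(2)] rank_nxt[of v "a v"] v by simp
  then have "a v = a' v" using step.prems by simp
  with step v show ?case by (simp add: visits_Var)
qed

lemma out_cong:
  assumes "\<And>v. rank (Var v) \<le> rank s \<Longrightarrow> a v = a' v" shows "out a s = out a' s"
  using assms
proof (induction s rule: state_rank_induct)
  case (Var v)
  have "out a (nxt v (a v)) = out a' (nxt v (a v))"
    using Var.prems rank_nxt[of v "a v"] by (intro Var.IH) auto
  then show ?case using Var.prems[of v] by (simp add: out_Var)
qed simp

text \<open>The two runs can only part at a node reading \<open>v\<close>. This is the source of all
  later facts about which variables a run must read.\<close>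

lemma sensitive_visits:
  assumes "out a s \<noteq> out a' s" "\<And>w. w \<noteq> v \<Longrightarrow> a w = a' w" shows "visits a s (Var v)"
  using assms(1)
proof (induction s rule: state_rank_induct)
  case (Var w)
  show ?case
  proof (cases "w = v")
    case False
    then show ?thesis using Var assms(2)[OF False] by (auto simp: out_Var visits_Var)
  qed simp
qed simp

end

section \<open>Programs for gamma_G and the path \<open>P\<close> of the input (0^n, 0^n,
  1^n)\<close>

abbreviation "asg \<equiv> case_gvar"

text \<open>The last three assumptions are clauses (1), (3) and (4), stated without precedence:
  where an earlier clause applies it gives the same value.\<close>

locale gamma_program = once_program nxt rank
  for nxt :: "gvar \<Rightarrow> bool \<Rightarrow> gvar state" and rank +
  fixes n :: nat and s0 :: "gvar state"
  assumes s0_vars: "s0 \<in> Var ` gamma_vars n \<union> range Out"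
    and nxt_vars: "nxt v b \<in> Var ` gamma_vars n \<union> range Out"
    and out_x0: "\<lbrakk>\<And>i. i \<in> {1..n} \<Longrightarrow> \<not> a (XVar i)\<rbrakk> \<Longrightarrow>
      out a s0 \<longleftrightarrow> (\<exists>i\<in>{1..n}. a (YVar i) \<and> a (ZVar i))"
    and out_z1: "\<lbrakk>\<And>i. i \<in> {1..n} \<Longrightarrow> a (ZVar i)\<rbrakk> \<Longrightarrow>
      out a s0 \<longleftrightarrow> (\<exists>i\<in>{1..n}. a (XVar i) \<or> a (YVar i))"
    and out_z0: "\<lbrakk>\<And>i. i \<in> {1..n} \<Longrightarrow> \<not> a (ZVar i)\<rbrakk> \<Longrightarrow> \<not> out a s0"
begin

abbreviation "base \<equiv> asg (\<lambda>_. False) (\<lambda>_. False) (\<lambda>_. True)"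

definition P :: "gvar state set" where "P = {t. visits base s0 t}"

lemma visited_vars: "visits a s0 t \<Longrightarrow> t \<in> Var ` gamma_vars n \<union> range Out"
  by (induction rule: rtranclp_induct) (use s0_vars nxt_vars in \<open>auto elim!: stepE\<close>)

lemma s0_P: "s0 \<in> P" by (simp add: P_def)

lemma nxt_P: "Var v \<in> P \<Longrightarrow> nxt v (base v) \<in> P"
  unfolding P_def using visits_nxt by blast

lemma not_out_base: "\<not> out base s0" by (subst out_x0) auto

lemma P_not_out: "t \<in> P \<Longrightarrow> \<not> out base t"
  using not_out_base out_visits[of base s0 t] by (auto simp: P_def)

lemma Out_False_P: "Out False \<in> P"
  using visits_Out_out[of base s0] not_out_base by (auto simp: P_def)

lemma X_P: assumes "k \<in> {1..n}" shows "Var (XVar k) \<in> P"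
  unfolding P_def mem_Collect_eq
proof (rule sensitive_visits)
  let ?a = "asg (\<lambda>i. i = k) (\<lambda>_. False) (\<lambda>_. True)"
  have "out ?a s0" using assms by (subst out_z1) auto
  then show "out base s0 \<noteq> out ?a s0" using not_out_base by simp
qed (auto split: gvar.splits)

lemma Y_P: assumes "k \<in> {1..n}" shows "Var (YVar k) \<in> P"
  unfolding P_def mem_Collect_eq
proof (rule sensitive_visits)
  let ?a = "asg (\<lambda>_. False) (\<lambda>i. i = k) (\<lambda>_. True)"
  have "out ?a s0" using assms by (subst out_z1) auto
  then show "out base s0 \<noteq> out ?a s0" using not_out_base by simp
qed (auto split: gvar.splits)

lemma off_P:
  assumes "t \<in> Var ` gamma_vars n \<union> range Out" "t \<notin> P"
  obtains "t = Out True" | d where "d \<in> {1..n}" "t = Var (ZVar d)"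
proof -
  consider b where "t = Out b" | i where "i \<in> {1..n}" "t = Var (XVar i) \<or> t = Var (YVar i) \<or> t = Var (ZVar i)"
    using assms(1) by (auto simp: gamma_vars_def)
  then show thesis
  proof cases
    case 1
    then show ?thesis using that(1) Out_False_P assms(2) by (cases b) auto
  next
    case 2
    then show ?thesis using that(2) X_P Y_P assms(2) by auto
  qed
qed

text \<open>If this edge returned to \<open>P\<close>, the rest of the run with only
  \<open>x_k\<close> raised would be that of \<open>base\<close> and reject, against clause
  (3).\<close>

lemma nxt_X_True_off_P: assumes "k \<in> {1..n}" shows "nxt (XVar k) True \<notin> P"
proof
  let ?w = "nxt (XVar k) True"
  let ?a = "asg (\<lambda>i. i = k) (\<lambda>_. False) (\<lambda>_. True)"
  assume "?w \<in> P"
  have "visits ?a s0 (Var (XVar k))"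
    using X_P[OF assms] unfolding P_def mem_Collect_eq
    by (rule visits_cong) (auto split: gvar.splits)
  from visits_nxt[OF this] have "visits ?a s0 ?w" by simp
  moreover have "out ?a s0" using assms by (subst out_z1) auto
  ultimately have "out ?a ?w" using out_visits by blast
  moreover have "out ?a ?w = out base ?w"
    using rank_nxt[of "XVar k" True] by (intro out_cong) (auto split: gvar.splits)
  ultimately show False using P_not_out[OF \<open>?w \<in> P\<close>] by simp
qed

text \<open>When \<open>y_j = 1\<close> and no other term \<open>y_i \<and> z_i\<close> holds,
  flipping \<open>z_j\<close> flips the value in clause (1), so \<open>z_j\<close> must be
  read.\<close>

lemma visits_Z:
  assumes "j \<in> {1..n}" "y j" "\<And>i. i \<in> {1..n} \<Longrightarrow> i \<noteq> j \<Longrightarrow> \<not> (y i \<and> z i)"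
  shows "visits (asg (\<lambda>_. False) y z) s0 (Var (ZVar j))"
proof (rule sensitive_visits)
  let ?a = "asg (\<lambda>_. False) y z" and ?a' = "asg (\<lambda>_. False) y (z(j := \<not> z j))"
  have "(\<exists>i\<in>{1..n}. y i \<and> z i) \<longleftrightarrow> z j"
    "(\<exists>i\<in>{1..n}. y i \<and> (z(j := \<not> z j)) i) \<longleftrightarrow> \<not> z j"
    using assms by (metis fun_upd_apply)+
  then have "out ?a s0 \<longleftrightarrow> z j" "out ?a' s0 \<longleftrightarrow> \<not> z j"
    using out_x0[of ?a] out_x0[of ?a'] by simp_all
  then show "out ?a s0 \<noteq> out ?a' s0" by simp
qed (auto split: gvar.splits)

text \<open>If \<open>y_c\<close> were not read before \<open>z_c\<close>, raising it would leave
  the way to \<open>z_c\<close> unchanged, and that way would be part of \<open>P\<close>.\<close>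

lemma Y_before_off_P_Z:
  assumes "c \<in> {1..n}" "Var (ZVar c) \<notin> P" shows "rank (Var (ZVar c)) < rank (Var (YVar c))"
proof (rule ccontr)
  assume *: "\<not> ?thesis"
  have "visits (asg (\<lambda>_. False) (\<lambda>i. i = c) (\<lambda>_. True)) s0 (Var (ZVar c))"
    using assms by (intro visits_Z) auto
  then have "visits base s0 (Var (ZVar c))"
    by (rule visits_cong) (use * in \<open>auto split: gvar.splits\<close>)
  then show False using assms(2) by (simp add: P_def)
qed

text \<open>After \<open>z_c\<close> the raised \<open>y_c\<close> is already forgotten, so the rest
  of the run is that of \<open>base\<close>; since it accepts, its first state is off
  \<open>P\<close>. If that state reads some \<open>z_d\<close>, the runs for \<open>y = e_c\<close>
  and \<open>y = e_d\<close> merge there although clause (1) must tell them apart.\<close>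

lemma nxt_off_P_Z_True:
  assumes "c \<in> {1..n}" "Var (ZVar c) \<notin> P" shows "nxt (ZVar c) True = Out True"
proof (rule ccontr)
  let ?u = "nxt (ZVar c) True"
  let ?a = "asg (\<lambda>_. False) (\<lambda>i. i = c) (\<lambda>_. True)"
  assume neq: "?u \<noteq> Out True"
  have "visits ?a s0 (Var (ZVar c))" using assms by (intro visits_Z) auto
  from visits_nxt[OF this] have vu: "visits ?a s0 ?u" by simp
  have "out ?a s0" using assms by (subst out_x0) auto
  then have "out ?a ?u" using out_visits[OF vu] by simp
  moreover have "out ?a ?u = out base ?u"
    using rank_nxt[of "ZVar c" True] Y_before_off_P_Z[OF assms]
    by (intro out_cong) (auto split: gvar.splits)
  ultimately have "?u \<notin> P" using P_not_out by blast
  then obtain d where d: "d \<in> {1..n}" "?u = Var (ZVar d)"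
    using off_P[OF nxt_vars] neq by metis
  with \<open>?u \<notin> P\<close> have dP: "Var (ZVar d) \<notin> P" by simp
  define r where "r = rank (Var (ZVar d))"
  \<comment> \<open>All ones on what is read before \<open>z_d\<close>, so the way to
    \<open>z_d\<close> survives, but \<open>z_c = 1\<close> and \<open>z_d = 0\<close>.\<close>
  define z where "z = (\<lambda>i. r < rank (Var (ZVar i)))"
  have rc: "r < rank (Var (ZVar c))" using rank_nxt[of "ZVar c" True] d by (simp add: r_def)
  have Yc: "r < rank (Var (YVar c))" using rc Y_before_off_P_Z[OF assms] by simp
  have Yd: "r < rank (Var (YVar d))" using Y_before_off_P_Z[OF d(1) dP] by (simp add: r_def)
  let ?m = "\<lambda>e. asg (\<lambda>_. False) (\<lambda>i. i = e) z"
  have "visits (?m c) s0 (Var (ZVar d))"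
    using vu[unfolded d(2)] by (rule visits_cong) (auto simp: z_def r_def split: gvar.splits)
  moreover have "out (?m c) s0" using assms rc by (subst out_x0) (auto simp: z_def)
  ultimately have 1: "out (?m c) (Var (ZVar d))" using out_visits by blast
  have "visits (?m d) s0 (Var (ZVar d))" using d by (intro visits_Z) auto
  moreover have "\<not> out (?m d) s0" by (subst out_x0) (auto simp: z_def r_def)
  ultimately have 2: "\<not> out (?m d) (Var (ZVar d))" using out_visits by blast
  have "out (?m c) (Var (ZVar d)) = out (?m d) (Var (ZVar d))"
    using Yc Yd by (intro out_cong) (auto simp: r_def split: gvar.splits)
  with 1 2 show False by simp
qed

text \<open>Otherwise the edge leads to some \<open>z_d\<close> off \<open>P\<close>, and raising
  \<open>z_d\<close> would make the program accept with \<open>y = e_j\<close> and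
  \<open>z_j = 0\<close>.\<close>

lemma nxt_Z_False_P: assumes "j \<in> {1..n}" shows "nxt (ZVar j) False \<in> P"
proof (rule ccontr)
  let ?u = "nxt (ZVar j) False"
  let ?a = "asg (\<lambda>_. False) (\<lambda>i. i = j) (\<lambda>_. False)"
  assume "?u \<notin> P"
  have "visits ?a s0 (Var (ZVar j))" using assms by (intro visits_Z) auto
  from visits_nxt[OF this] have vu: "visits ?a s0 ?u" by simp
  have "\<not> out ?a s0" by (subst out_x0) auto
  then have "?u \<noteq> Out True" using out_visits[OF vu] by auto
  with \<open>?u \<notin> P\<close> obtain d where d: "d \<in> {1..n}" "?u = Var (ZVar d)"
    using off_P[OF nxt_vars] by metis
  let ?b = "asg (\<lambda>_. False) (\<lambda>i. i = j) (\<lambda>i. i = d)"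
  have "visits ?b s0 (Var (ZVar d))"
    using vu[unfolded d(2)] by (rule visits_cong) (auto split: gvar.splits)
  from visits_nxt[OF this] have "visits ?b s0 (Out True)"
    using nxt_off_P_Z_True[of d] d \<open>?u \<notin> P\<close> by simp
  then have "out ?b s0" by (simp add: out_def)
  moreover have "d \<noteq> j" using rank_nxt[of "ZVar j" False] d by auto
  then have "\<not> out ?b s0" by (subst out_x0) auto
  ultimately show False by simp
qed

text \<open>The stretch of \<open>P\<close> that the 0-edge of \<open>z_b\<close> jumps over. Ranks
  decrease strictly along \<open>P\<close>, so they serve as positions on it.\<close>

definition block :: "nat \<Rightarrow> gvar state set" where
  "block b = {t \<in> P. Var (ZVar b) \<in> P \<and>
     rank (nxt (ZVar b) False) < rank t \<and> rank t < rank (Var (ZVar b))}"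

text \<open>For \<open>x = z = 0\<^sup>n\<close> and \<open>y\<close> the indicator of \<open>{j, b}\<close>, both \<open>z\<^sub>j\<close> and \<open>z\<^sub>b\<close> are sensitive, hence
  read, so neither \<open>0\<close>-edge may bypass the node of the other.\<close>

lemma nxt_Z_False_not_block:
  assumes "j \<in> {1..n}" "b \<in> {1..n}" shows "nxt (ZVar j) False \<notin> block b"
proof
  let ?a = "asg (\<lambda>_. False) (\<lambda>i. i = j \<or> i = b) (\<lambda>_. False)"
  assume "nxt (ZVar j) False \<in> block b"
  then have less: "rank (nxt (ZVar b) False) < rank (nxt (ZVar j) False)"
    "rank (nxt (ZVar j) False) < rank (Var (ZVar b))" by (auto simp: block_def)
  then have "j \<noteq> b" by auto
  have v: "visits ?a s0 (Var (ZVar j))" "visits ?a s0 (Var (ZVar b))"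
    using assms by (auto intro!: visits_Z)
  from visits_linear[OF this] \<open>j \<noteq> b\<close>
  have "visits ?a (nxt (ZVar j) False) (Var (ZVar b)) \<or> visits ?a (nxt (ZVar b) False) (Var (ZVar j))"
    by (auto simp: visits_Var)
  then show False
    using less rank_nxt[of "ZVar j" False] by (auto dest!: visits_rank)
qed

text \<open>Along \<open>P\<close> a block can be entered from outside only through
  \<open>z_b\<close>, and \<open>base\<close> leaves that node by its 1-edge.\<close>

lemma block_pred:
  assumes "Var v \<in> P" "nxt v (base v) \<in> block b" "v \<noteq> ZVar b" shows "Var v \<in> block b"
proof -
  let ?t = "nxt v (base v)"
  have Zb: "Var (ZVar b) \<in> P" and r: "rank (nxt (ZVar b) False) < rank ?t" "rank ?t < rank (Var (ZVar b))"
    using assms(2) by (auto simp: block_def)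
  have "rank (Var v) < rank (Var (ZVar b))"
  proof (rule ccontr)
    assume "\<not> ?thesis"
    then have "visits base (Var v) (Var (ZVar b))"
      using assms(1) Zb by (auto simp: P_def intro: visits_later[of base s0])
    then have "visits base ?t (Var (ZVar b))" using assms(3) by (simp add: visits_Var)
    then show False using visits_rank[of base ?t] r by fastforce
  qed
  then show ?thesis using assms(1) Zb r rank_nxt[of v "base v"] by (simp add: block_def)
qed

text \<open>If no 0-edge of a \<open>z\<close>-node jumps over \<open>x_k\<close>, the all-zero
  input reaches \<open>x_k\<close>; raising \<open>x_k\<close> then accepts with
  \<open>z = 0^n\<close>, against clause (4).\<close>

lemma nxt_X_True_block:
  assumes k: "k \<in> {1..n}" and sink: "nxt (XVar k) True = Out True"
  shows "\<exists>b\<in>{1..n}. Var (XVar k) \<in> block b"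
proof (rule ccontr)
  assume no: "\<not> ?thesis"
  let ?x = "Var (XVar k)" and ?z = "asg (\<lambda>_. False) (\<lambda>_. False) (\<lambda>_. False)"
  have "visits ?z t ?x" if "t \<in> P" "rank ?x \<le> rank t" for t
    using that
  proof (induction t rule: state_rank_induct)
    case (Out b)
    \<comment> \<open>The locale fixes no rank for sinks, so this case is refuted by path order:
      nothing follows a sink.\<close>
    then have "visits base (Out b) ?x"
      using X_P[OF k] by (auto simp: P_def intro: visits_later[of base s0])
    then show ?case by (simp add: visits_Out)
  next
    case (Var v)
    show ?case
    proof (cases "v = XVar k")
      case False
      have *: "visits base (Var v) ?x"
        using X_P[OF k] Var.prems by (auto simp: P_def intro: visits_later[of base s0])
      then have later: "rank ?x \<le> rank (nxt v (base v))" and less: "rank ?x < rank (Var v)"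
        using False visits_rank[of base "nxt v (base v)" ?x] visits_rank_less[OF *] by (auto simp: visits_Var)
      \<comment> \<open>The all-zero input differs from \<open>base\<close> only at
        \<open>z\<close>-nodes, whose 0-edges return to \<open>P\<close> and cannot pass
        \<open>x_k\<close>, as it lies in no block.\<close>
      have "nxt v (?z v) \<in> P \<and> rank ?x \<le> rank (nxt v (?z v))"
      proof (cases "\<exists>j. v = ZVar j")
        case True
        then obtain j where j: "v = ZVar j" by blast
        have "j \<in> {1..n}" using visited_vars[of base "Var v"] Var.prems(1) j
          by (auto simp: P_def gamma_vars_def)
        then show ?thesis
          using no nxt_Z_False_P[of j] X_P[OF k] Var.prems(1) less unfolding j block_def
          by (auto simp: not_less)
      next
        case False
        then have "base v = ?z v" by (cases v) auto
        then show ?thesis using later nxt_P[OF Var.prems(1)] by metis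
      qed
      then show ?thesis using Var.IH by (simp add: visits_Var)
    qed simp
  qed
  moreover have "rank ?x \<le> rank s0" using X_P[OF k] visits_rank[of base s0 ?x] by (simp add: P_def)
  ultimately have v0: "visits ?z s0 ?x" using s0_P by blast
  let ?e = "asg (\<lambda>i. i = k) (\<lambda>_. False) (\<lambda>_. False)"
  have "visits ?e s0 ?x" using v0 by (rule visits_cong) (auto split: gvar.splits)
  from visits_nxt[OF this] have "out ?e s0" using sink by (simp add: out_def)
  moreover have "\<not> out ?e s0" by (rule out_z0) simp
  ultimately show False by simp
qed

section \<open>Partners \<open>\<sigma> k\<close> of the \<open>x_k\<close> and the bound on
  accepted inputs\<close>

definition partner :: "nat \<Rightarrow> nat \<Rightarrow> bool" where
  "partner k j \<longleftrightarrow> (if nxt (XVar k) True = Out True then Var (XVar k) \<in> block j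
     else nxt (XVar k) True = Var (ZVar j))"

lemma partner_ex: assumes "k \<in> {1..n}" shows "\<exists>j\<in>{1..n}. partner k j"
  using off_P[OF nxt_vars nxt_X_True_off_P[OF assms]] nxt_X_True_block[OF assms]
  unfolding partner_def by metis

text \<open>A run with \<open>y = 0^n\<close> is on \<open>P\<close>, inside a block only if that
  block was entered through \<open>z_b = 1\<close>; or it has left \<open>P\<close> through some
  \<open>x_k = 1\<close> and is about to test the partner; or it has accepted with a witness
  \<open>k\<close>. Every 0-edge of a \<open>z\<close>-node leads back to \<open>P\<close> outside
  all blocks, which restores the first alternative.\<close>

lemma visits_invariant:
  assumes y: "\<And>i. i \<in> {1..n} \<Longrightarrow> \<not> a (YVar i)"
    and \<sigma>: "\<And>k. k \<in> {1..n} \<Longrightarrow> partner k (\<sigma> k)" "\<And>k. k \<in> {1..n} \<Longrightarrow> \<sigma> k \<in> {1..n}"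
    and v: "visits a s0 t"
  shows "(t \<in> P \<and> (\<forall>b\<in>{1..n}. t \<in> block b \<longrightarrow> a (ZVar b))) \<or>
    (\<exists>k\<in>{1..n}. a (XVar k) \<and> t = Var (ZVar (\<sigma> k)) \<and> t \<notin> P) \<or>
    (t = Out True \<and> (\<exists>k\<in>{1..n}. a (XVar k) \<and> a (ZVar (\<sigma> k))))"
    (is "?I t")
  using v
proof (induction rule: rtranclp_induct)
  case base
  have "s0 \<notin> block b" for b
    using visits_rank[of base s0 "Var (ZVar b)"] by (auto simp: block_def P_def)
  then show ?case using s0_P by blast
next
  case (step t u)
  from step.hyps(2) obtain v where v: "t = Var v" "u = nxt v (a v)" by (auto elim: stepE)
  have mem: "v \<in> gamma_vars n" using visited_vars[OF step.hyps(1)] v by auto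
  show ?case
  proof (cases "t \<in> P")
    case True
    then have inb: "a (ZVar b)" if "b \<in> {1..n}" "t \<in> block b" for b using step.IH that v by auto
    \<comment> \<open>As \<open>y = 0^n\<close>, a deviation from \<open>base\<close> is either
      \<open>x_k = 1\<close> or \<open>z_j = 0\<close>.\<close>
    consider (adv) "a v = base v" | (X) k where "v = XVar k" "k \<in> {1..n}" "a v"
      | (Z) j where "v = ZVar j" "j \<in> {1..n}" "\<not> a v"
      using mem y that by (cases v; cases "a v") (auto simp: gamma_vars_def)
    then show ?thesis
    proof cases
      case adv
      have "a (ZVar b)" if "b \<in> {1..n}" "u \<in> block b" for b
      proof (cases "v = ZVar b")
        case True
        then show ?thesis using adv by simp
      next
        case False
        then show ?thesis using block_pred[of v b] inb that True v adv by metis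
      qed
      moreover have "u \<in> P" using nxt_P True v adv by metis
      ultimately show ?thesis by blast
    next
      case X
      have u: "u = nxt (XVar k) True" using X v by simp
      show ?thesis
      proof (cases "u = Out True")
        case True
        then have "Var (XVar k) \<in> block (\<sigma> k)" using \<sigma>(1)[OF X(2)] u by (simp add: partner_def)
        then have "a (ZVar (\<sigma> k))" using inb \<sigma>(2) X v by blast
        then show ?thesis using True X by blast
      next
        case False
        then have "u = Var (ZVar (\<sigma> k))" using \<sigma>(1)[OF X(2)] u by (simp add: partner_def)
        moreover have "u \<notin> P" "a (XVar k)" using nxt_X_True_off_P[OF X(2)] u X by auto
        ultimately show ?thesis using X(2) by blast
      qed
    next
      case Z
      then show ?thesis using nxt_Z_False_P nxt_Z_False_not_block v by auto
    qed
  next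
    case False
    then obtain k where k: "k \<in> {1..n}" "a (XVar k)" "v = ZVar (\<sigma> k)"
      using step.IH v by auto
    show ?thesis
    proof (cases "a v")
      case True
      then show ?thesis using nxt_off_P_Z_True[of "\<sigma> k"] \<sigma>(2) k v False by auto
    next
      case False
      then show ?thesis using nxt_Z_False_P nxt_Z_False_not_block \<sigma>(2) k v by auto
    qed
  qed
qed

text \<open>The sink 1 is neither on \<open>P\<close> nor a \<open>z\<close>-node, so only the third
  alternative of the invariant remains. The choice of \<open>\<sigma>\<close> does not depend on the
  input.\<close>

lemma out_upper_bound:
  obtains \<sigma> where "\<sigma> ` {1..n} \<subseteq> {1..n}"
    "\<And>a. \<lbrakk>\<And>i. i \<in> {1..n} \<Longrightarrow> \<not> a (YVar i); out a s0\<rbrakk> \<Longrightarrow>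
      \<exists>k\<in>{1..n}. a (XVar k) \<and> a (ZVar (\<sigma> k))"
proof -
  obtain \<sigma> where \<sigma>: "\<And>k. k \<in> {1..n} \<Longrightarrow> partner k (\<sigma> k) \<and> \<sigma> k \<in> {1..n}"
    using partner_ex by metis
  have "\<exists>k\<in>{1..n}. a (XVar k) \<and> a (ZVar (\<sigma> k))"
    if "\<And>i. i \<in> {1..n} \<Longrightarrow> \<not> a (YVar i)" "out a s0" for a
    using visits_invariant[of a \<sigma> "Out True"] that \<sigma> P_not_out[of "Out True"]
    by (auto simp: out_def[of a])
  with \<sigma> that show thesis by blast
qed

end

section \<open>From once-appearance branching programs to ranked transition systems\<close>

lemma once_program_of_oabp:
  assumes "is_oabp V B"
  obtains nxt rank s0 where "once_program nxt rank"
    "s0 \<in> Var ` V \<union> range Out" "\<And>v b. nxt v b \<in> Var ` V \<union> range Out"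
    "\<And>a b. bp_outputs B a b \<Longrightarrow> once_program.out nxt a s0 = b"
proof -
  let ?I = "inner_nodes B" and ?E = "bp_edges B"
  have bp: "finite (nodes B)" "range (sink B) \<subseteq> nodes B" "sink B False \<noteq> sink B True"
    "\<And>u. u \<in> ?I \<Longrightarrow> label B u \<in> V" "\<And>u b. u \<in> ?I \<Longrightarrow> succ B u b \<in> nodes B"
    "acyclic ?E" "{v \<in> nodes B. \<forall>u. (u, v) \<notin> ?E} = {source B}"
    and inj: "inj_on (label B) ?I"
    using assms by (auto simp: is_oabp_def is_bp_def)
  define st where "st u = (if u \<in> ?I then Var (label B u) else Out (u = sink B True))" for u
  define node where "node = inv_into ?I (label B)"
  \<comment> \<open>Variables labelling no node get a default transition to a sink, which keeps
    \<open>nxt\<close> total and rank-decreasing.\<close>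
  define nxt where "nxt v b = (if v \<in> label B ` ?I then st (succ B (node v) b) else Out False)" for v b
  define desc where "desc u = {w. (u, w) \<in> ?E\<^sup>+}" for u
  \<comment> \<open>The number of proper descendants strictly decreases along edges by acyclicity;
    \<open>Suc\<close> puts every variable above the sinks.\<close>
  define rank where "rank s = (case s of Out _ \<Rightarrow> 0 | Var v \<Rightarrow> Suc (card (desc (node v))))" for s
  have node: "node (label B u) = u" if "u \<in> ?I" for u using inj that by (simp add: node_def)
  have st_in: "st u \<in> Var ` V \<union> range Out" for u using bp(4) by (auto simp: st_def)
  have "?E \<subseteq> nodes B \<times> nodes B" using bp(5) by (auto simp: bp_edges_def inner_nodes_def)
  then have fin: "finite (desc u)" for u
    using trancl_subset_Sigma[of ?E "nodes B"] bp(1) unfolding desc_def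
    by (auto intro: finite_subset[of _ "nodes B"])
  have desc_less: "card (desc w) < card (desc u)" if "(u, w) \<in> ?E" for u w
  proof (intro psubset_card_mono fin psubsetI)
    show "desc w \<subseteq> desc u" using that by (auto simp: desc_def)
    have "w \<in> desc u" "w \<notin> desc w" using that bp(6) by (auto simp: desc_def acyclic_def)
    then show "desc w \<noteq> desc u" by blast
  qed
  have prog: "once_program nxt rank"
  proof
    fix v b
    show "rank (nxt v b) < rank (Var v)"
    proof (cases "v \<in> label B ` ?I")
      case True
      then obtain u where u: "u \<in> ?I" "v = label B u" by blast
      then have "(u, succ B u b) \<in> ?E" by (auto simp: bp_edges_def)
      then show ?thesis using u desc_less by (auto simp: nxt_def st_def rank_def node)
    qed (simp add: nxt_def rank_def)
  qed
  then interpret once_program nxt rank .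
  have sim: "visits a (st u) (st w)" if "(u, w) \<in> (bp_step B a)\<^sup>*" for a u w
    using that
  proof (induction rule: rtrancl_induct)
    case (step w w')
    then have w: "w \<in> ?I" "w' = succ B w (a (label B w))" by (auto simp: bp_step_def)
    then have "st w = Var (label B w)" "st w' = nxt (label B w) (a (label B w))"
      by (auto simp: st_def[of w] nxt_def node)
    then show ?case using step.IH visits_nxt by simp
  qed simp
  have sink: "st (sink B b) = Out b" for b
    using bp(3) by (cases b) (auto simp: st_def inner_nodes_def)
  have outputs: "out a (st (source B)) = b" if "bp_outputs B a b" for a b
    using out_visits[OF sim] that unfolding bp_outputs_def by (metis sink out_Out)
  have nxt_in: "nxt v b \<in> Var ` V \<union> range Out" for v b using st_in by (simp add: nxt_def)
  show thesis by (rule that[OF prog st_in nxt_in outputs])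
qed

section \<open>Values of gamma_G on the inputs that are used\<close>

lemma gamma_fun_x0:
  "(\<And>i. i \<in> {1..n} \<Longrightarrow> \<not> a (XVar i)) \<Longrightarrow>
    gamma_fun n E a = Some (\<exists>i\<in>{1..n}. a (YVar i) \<and> a (ZVar i))"
  by (simp add: gamma_fun_def gamma_def vec_eq_def const_vec_def)

lemma gamma_fun_x1:
  assumes "n \<ge> 1" "\<And>i. i \<in> {1..n} \<Longrightarrow> a (XVar i)"
  shows "gamma_fun n E a = Some (\<exists>i\<in>{1..n}. a (ZVar i))"
proof -
  have "a (XVar 1)" using assms by simp
  then have "\<not> vec_eq n (\<lambda>i. a (XVar i)) (const_vec False)" "vec_eq n (\<lambda>i. a (XVar i)) (const_vec True)"
    using assms by (auto simp: vec_eq_def const_vec_def intro!: bexI[of _ 1])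
  then show ?thesis by (simp add: gamma_fun_def gamma_def)
qed

text \<open>Clauses (1) and (2) take precedence, but for \<open>z = 1^n\<close> their values
  coincide with that of clause (3).\<close>

lemma gamma_fun_z1:
  assumes "n \<ge> 1" "\<And>i. i \<in> {1..n} \<Longrightarrow> a (ZVar i)"
  shows "gamma_fun n E a = Some (\<exists>i\<in>{1..n}. a (XVar i) \<or> a (YVar i))"
proof -
  consider "\<forall>i\<in>{1..n}. \<not> a (XVar i)" | "\<forall>i\<in>{1..n}. a (XVar i)"
    | "\<not> (\<forall>i\<in>{1..n}. \<not> a (XVar i))" "\<not> (\<forall>i\<in>{1..n}. a (XVar i))" by blast
  then show ?thesis
  proof cases
    case 1
    then show ?thesis using assms(2) by (subst gamma_fun_x0) auto
  next
    case 2
    have "1 \<in> {1..n}" using assms(1) by simp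
    then have "(\<exists>i\<in>{1..n}. a (ZVar i)) = (\<exists>i\<in>{1..n}. a (XVar i) \<or> a (YVar i))"
      using assms(2) 2 by blast
    then show ?thesis using assms(1) 2 by (subst gamma_fun_x1) auto
  next
    case 3
    then have "\<not> vec_eq n (\<lambda>i. a (XVar i)) (const_vec False)"
      "\<not> vec_eq n (\<lambda>i. a (XVar i)) (const_vec True)" "vec_eq n (\<lambda>i. a (ZVar i)) (const_vec True)"
      using assms(2) unfolding vec_eq_def const_vec_def by blast+
    then show ?thesis by (simp add: gamma_fun_def gamma_def)
  qed
qed

lemma gamma_fun_z0:
  assumes "n \<ge> 1" "\<And>i. i \<in> {1..n} \<Longrightarrow> \<not> a (ZVar i)"
  shows "gamma_fun n E a = Some False"
proof -
  have "1 \<in> {1..n}" using assms(1) by simp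
  then have "\<not> vec_eq n (\<lambda>i. a (ZVar i)) (const_vec True)" "vec_eq n (\<lambda>i. a (ZVar i)) (const_vec False)"
    "\<not> (\<exists>i\<in>{1..n}. a (YVar i) \<and> a (ZVar i))" "\<not> (\<exists>i\<in>{1..n}. a (ZVar i))"
    using assms(2) unfolding vec_eq_def const_vec_def by blast+
  \<comment> \<open>Clauses (1) and (2) also yield 0 here, so all branches reached have the same
    value.\<close>
  then show ?thesis
    unfolding gamma_fun_def gamma_def Let_def by (simp only: if_True if_False if_cancel)
qed

lemma gamma_fun_lower_half:
  assumes "even n" "n \<ge> 4" "k \<in> {1..n div 2}"
  shows "gamma_fun n E (asg (\<lambda>i. i = k) (\<lambda>_. False) (\<lambda>i. i \<le> n div 2)) = Some True"
proof -
  let ?x = "\<lambda>i. i = k" and ?z = "\<lambda>i. i \<le> n div 2"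
  have k: "k \<in> {1..n}" "n \<noteq> k" and n: "n \<in> {1..n}" "\<not> n \<le> n div 2" "1 \<in> {1..n}" "1 \<le> n div 2"
    using assms by auto
  have "\<not> vec_eq n ?x (const_vec False)" "\<not> vec_eq n ?x (const_vec True)"
    "\<not> vec_eq n ?z (const_vec True)" "\<not> vec_eq n ?z (const_vec False)"
    using k n unfolding vec_eq_def const_vec_def simp_thms by blast+
  moreover have "vec_eq n ?z (concat_vec (n div 2) (const_vec True) (const_vec False))"
    "vec_eq n (\<lambda>_. False) (const_vec False)"
    by (simp_all add: vec_eq_def concat_vec_def const_vec_def)
  ultimately show ?thesis using assms(3) by (simp add: gamma_fun_def gamma_def)
qed

lemma gamma_fun_upper_half:
  assumes "even n" "n \<ge> 4" "k \<in> {n div 2 + 1..n}"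
  shows "gamma_fun n E (asg (\<lambda>i. i = k) (\<lambda>_. False) (\<lambda>i. n div 2 < i)) = Some True"
proof -
  let ?x = "\<lambda>i. i = k" and ?z = "\<lambda>i. n div 2 < i"
  have k: "k \<in> {1..n}" "1 \<noteq> k" and n: "n \<in> {1..n}" "n div 2 < n" "1 \<in> {1..n}" "\<not> n div 2 < 1" "1 \<le> n div 2"
    using assms by auto
  have "\<not> vec_eq n ?x (const_vec False)" "\<not> vec_eq n ?x (const_vec True)"
    "\<not> vec_eq n ?z (const_vec True)" "\<not> vec_eq n ?z (const_vec False)"
    using k n unfolding vec_eq_def const_vec_def simp_thms by blast+
  moreover have "\<not> vec_eq n ?z (concat_vec (n div 2) (const_vec True) (const_vec False))"
    using n unfolding vec_eq_def concat_vec_def const_vec_def by (metis (full_types))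
  moreover have "vec_eq n ?z (concat_vec (n div 2) (const_vec False) (const_vec True))"
    "vec_eq n (\<lambda>_. False) (const_vec False)"
    by (auto simp: vec_eq_def concat_vec_def const_vec_def)
  ultimately show ?thesis using assms(3) by (simp add: gamma_fun_def gamma_def)
qed

lemma gamma_fun_edge:
  assumes "even n" "n \<ge> 4" "(j, k) \<in> J1 n" "(j', k') \<in> J2 n" "{(j, k), (j', k')} \<in> E"
  shows "gamma_fun n E (asg (\<lambda>i. i \<noteq> k \<and> i \<noteq> k') (\<lambda>_. False) (\<lambda>i. i = j \<or> i = j')) = Some True"
proof -
  define h where "h = n div 2"
  have n: "n = 2 * h" "h \<ge> 2" using assms by (auto simp: h_def)
  have jk: "j \<in> {1..h}" "k \<in> {1..h}" using assms(3) by (auto simp: J1_def h_def)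
  obtain l m where lm: "j' = h + l" "k' = h + m" "l \<in> {1..h}" "m \<in> {1..h}"
  proof
    show "j' = h + (j' - h)" "k' = h + (k' - h)" "j' - h \<in> {1..h}" "k' - h \<in> {1..h}"
      using assms(4) n by (auto simp: J2_def)
  qed
  let ?x = "\<lambda>i. i \<noteq> k \<and> i \<noteq> k'" and ?z = "\<lambda>i. i = j \<or> i = j'"
  \<comment> \<open>A second index in the lower half makes \<open>x\<close> nonzero; for
    \<open>n = 2\<close> there is none and clause (1) claims the input.\<close>
  obtain i where i: "i \<in> {1..h}" "i \<noteq> k"
    using n(2) that[of 1] that[of 2] by (cases "k = 1") auto
  obtain i' where i': "i' \<in> {1..h}" "i' \<noteq> j"
    using n(2) that[of 1] that[of 2] by (cases "j = 1") auto
  have x0: "\<not> vec_eq n ?x (const_vec False)"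
    using i lm n by (auto simp: vec_eq_def const_vec_def intro!: bexI[of _ i])
  have x1: "\<not> vec_eq n ?x (const_vec True)"
    using jk n by (auto simp: vec_eq_def const_vec_def intro!: bexI[of _ k])
  have z1: "\<not> vec_eq n ?z (const_vec True)"
    using i' lm n by (auto simp: vec_eq_def const_vec_def intro!: bexI[of _ i'])
  have z0: "\<not> vec_eq n ?z (const_vec False)"
    using jk n by (auto simp: vec_eq_def const_vec_def intro!: bexI[of _ j])
  have zl: "\<not> vec_eq n ?z (concat_vec h (const_vec True) (const_vec False))"
    using lm n by (auto simp: vec_eq_def const_vec_def concat_vec_def intro!: bexI[of _ j'])
  have zu: "\<not> vec_eq n ?z (concat_vec h (const_vec False) (const_vec True))"
    using jk n by (auto simp: vec_eq_def const_vec_def concat_vec_def intro!: bexI[of _ j])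
  have "vec_eq n ?x (concat_vec h (compl_vec (unit_vec k)) (compl_vec (unit_vec m)))"
    "vec_eq n ?z (concat_vec h (unit_vec j) (unit_vec l))"
    using jk lm by (auto simp: vec_eq_def concat_vec_def compl_vec_def unit_vec_def)
  moreover have "vec_eq n (\<lambda>_. False) (const_vec False)" by (simp add: vec_eq_def const_vec_def)
  moreover have "{(j, k), (h + l, h + m)} \<in> E" using assms(5) lm by simp
  ultimately have "\<exists>j\<in>{1..h}. \<exists>k\<in>{1..h}. \<exists>j'\<in>{1..h}. \<exists>k'\<in>{1..h}.
      {(j, k), (h + j', h + k')} \<in> E \<and>
      vec_eq n ?x (concat_vec h (compl_vec (unit_vec k)) (compl_vec (unit_vec k'))) \<and>
      vec_eq n (\<lambda>_. False) (const_vec False) \<and>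
      vec_eq n ?z (concat_vec h (unit_vec j) (unit_vec j'))"
    using jk lm(3,4) by blast
  then show ?thesis
    using x0 x1 z0 z1 zl zu unfolding gamma_fun_def gamma_def Let_def h_def[symmetric] gvar.case
    by (simp only: if_True if_False simp_thms)
qed

section \<open>From a branching program to an independent permutation graph\<close>

lemma bpis_yes_if_oabp:
  assumes n: "even n" "n \<ge> 4" and graph: "bpis_graph n E"
    and B: "is_oabp (gamma_vars n) B" "bp_computes B (gamma_fun n E)"
  shows "bpis_yes n E"
proof -
  obtain nxt rank s0 where prog: "once_program nxt rank"
    and vars: "s0 \<in> Var ` gamma_vars n \<union> range Out" "\<And>v b. nxt v b \<in> Var ` gamma_vars n \<union> range Out"
    and outputs: "\<And>a b. bp_outputs B a b \<Longrightarrow> once_program.out nxt a s0 = b"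
    using once_program_of_oabp[OF B(1)] by metis
  interpret once_program nxt rank by (fact prog)
  have val: "out a s0 = b" if "gamma_fun n E a = Some b" for a b
    using outputs B(2) that by (auto simp: bp_computes_def)
  have n1: "n \<ge> 1" using n by simp
  interpret gamma_program nxt rank n s0
  proof unfold_locales
    fix a v b
    show "s0 \<in> Var ` gamma_vars n \<union> range Out" "nxt v b \<in> Var ` gamma_vars n \<union> range Out"
      by (fact vars)+
    show "out a s0 \<longleftrightarrow> (\<exists>i\<in>{1..n}. a (YVar i) \<and> a (ZVar i))"
      if "\<And>i. i \<in> {1..n} \<Longrightarrow> \<not> a (XVar i)" using val[OF gamma_fun_x0[of n a E, OF that]] .
    show "out a s0 \<longleftrightarrow> (\<exists>i\<in>{1..n}. a (XVar i) \<or> a (YVar i))"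
      if "\<And>i. i \<in> {1..n} \<Longrightarrow> a (ZVar i)" using val[OF gamma_fun_z1[of n a E, OF n1 that]] .
    show "\<not> out a s0" if "\<And>i. i \<in> {1..n} \<Longrightarrow> \<not> a (ZVar i)"
      using val[OF gamma_fun_z0[of n a E, OF n1 that]] by simp
  qed
  obtain \<sigma> where \<sigma>: "\<sigma> ` {1..n} \<subseteq> {1..n}"
    and bound: "\<And>a. \<lbrakk>\<And>i. i \<in> {1..n} \<Longrightarrow> \<not> a (YVar i); out a s0\<rbrakk> \<Longrightarrow>
      \<exists>k\<in>{1..n}. a (XVar k) \<and> a (ZVar (\<sigma> k))"
    using out_upper_bound by blast
  \<comment> \<open>Clause (2) accepts \<open>x = 1^n\<close>, \<open>z = e_j\<close>, and the bound
    then exhibits a preimage of \<open>j\<close>.\<close>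
  have "j \<in> \<sigma> ` {1..n}" if j: "j \<in> {1..n}" for j
  proof -
    let ?a = "asg (\<lambda>_. True) (\<lambda>_. False) (\<lambda>i. i = j)"
    have "out ?a s0" using j val[OF gamma_fun_x1[of n ?a E, OF n1]] by auto
    then show ?thesis using bound[of ?a] by auto
  qed
  then have surj: "\<sigma> ` {1..n} = {1..n}" using \<sigma> by blast
  then have inj: "inj_on \<sigma> {1..n}" by (intro eq_card_imp_inj_on) auto
  have lower: "\<sigma> k \<le> n div 2" if "k \<in> {1..n div 2}" for k
    using bound[of "asg (\<lambda>i. i = k) (\<lambda>_. False) (\<lambda>i. i \<le> n div 2)"]
      val[OF gamma_fun_lower_half[OF n that]] by auto
  have upper: "n div 2 < \<sigma> k" if "k \<in> {n div 2 + 1..n}" for k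
    using bound[of "asg (\<lambda>i. i = k) (\<lambda>_. False) (\<lambda>i. n div 2 < i)"]
      val[OF gamma_fun_upper_half[OF n that]] by auto
  \<comment> \<open>The \<open>z\<close>-index comes first and the \<open>x\<close>-index second, as
    in clause (7).\<close>
  define S where "S = (\<lambda>k. (\<sigma> k, k)) ` {1..n}"
  have "(\<sigma> k, k) \<in> J1 n \<union> J2 n" if "k \<in> {1..n}" for k
  proof -
    have "\<sigma> k \<in> {1..n}" using \<sigma> that by blast
    then show ?thesis using that lower[of k] upper[of k] by (cases "k \<le> n div 2") (auto simp: J1_def J2_def)
  qed
  then have sub: "S \<subseteq> J1 n \<union> J2 n" unfolding S_def by blast
  have "{u, v} \<notin> E" if "u \<in> S" "v \<in> S" for u v
  proof
    assume e: "{u, v} \<in> E"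
    then obtain u' v' where uv: "u' \<in> J1 n" "v' \<in> J2 n" "{u, v} = {u', v'}"
      using graph unfolding bpis_graph_def by blast
    then have "u' \<in> S" "v' \<in> S" using that by (auto simp: doubleton_eq_iff)
    then obtain k k' where k: "k \<in> {1..n}" "k' \<in> {1..n}" "u' = (\<sigma> k, k)" "v' = (\<sigma> k', k')"
      by (auto simp: S_def)
    let ?a = "asg (\<lambda>i. i \<noteq> k \<and> i \<noteq> k') (\<lambda>_. False) (\<lambda>i. i = \<sigma> k \<or> i = \<sigma> k')"
    have "gamma_fun n E ?a = Some True" using uv e k by (intro gamma_fun_edge[OF n]) auto
    then have "out ?a s0" using val by blast
    \<comment> \<open>The bound needs an \<open>m\<close> with \<open>x_m = 1\<close>, hence
      different from \<open>k\<close> and \<open>k'\<close>, sharing its image with one of them;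
      injectivity forbids this.\<close>
    then obtain m where "m \<in> {1..n}" "m \<noteq> k" "m \<noteq> k'" "\<sigma> m = \<sigma> k \<or> \<sigma> m = \<sigma> k'"
      using bound[of ?a] by auto
    then show False using inj k(1,2) by (metis inj_onD)
  qed
  then have "independent_set E S" by (simp add: independent_set_def)
  moreover have "card S = n" by (simp add: S_def card_image inj_on_def)
  moreover have "(\<exists>j. (i, j) \<in> S) \<and> (\<exists>k. (k, i) \<in> S)" if "i \<in> {1..n}" for i
  proof -
    have "i \<in> \<sigma> ` {1..n}" using that surj by simp
    then obtain j where "j \<in> {1..n}" "i = \<sigma> j" by (rule imageE)
    then have "(i, j) \<in> S" "(\<sigma> i, i) \<in> S" using that by (simp_all add: S_def del: atLeastAtMost_iff)
    then show ?thesis by blast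
  qed
  ultimately show ?thesis using sub unfolding bpis_yes_def by blast
qed

section \<open>A branching program for the read-once formula\<close>

text \<open>For \<open>\<Or>\<^sub>i z\<^sub>i \<and> (x\<^bsub>\<pi> i\<^esub> \<or> y\<^sub>i)\<close>: nodes \<open>3i - 3\<close>, \<open>3i - 2\<close>, \<open>3i - 1\<close> read \<open>z\<^sub>i\<close>, \<open>x\<^bsub>\<pi> i\<^esub>\<close>, \<open>y\<^sub>i\<close>,
  so that the failure exit of the last block is the sink \<open>3n\<close>.\<close>

definition dnf_bp :: "nat \<Rightarrow> (nat \<Rightarrow> nat) \<Rightarrow> gvar bp" where
  "dnf_bp n \<pi> = \<lparr>nodes = {..<3 * n + 2}, source = 0, sink = (\<lambda>b. if b then 3 * n + 1 else 3 * n),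
     label = (\<lambda>u. let i = u div 3 + 1 in
       if u mod 3 = 0 then ZVar i else if u mod 3 = 1 then XVar (\<pi> i) else YVar i),
     succ = (\<lambda>u b. if u mod 3 = 0 then (if b then u + 1 else u + 3)
       else if b then 3 * n + 1 else u + 1)\<rparr>"

lemma dnf_bp_sel:
  "nodes (dnf_bp n \<pi>) = {..<3 * n + 2}"
  "source (dnf_bp n \<pi>) = 0"
  "sink (dnf_bp n \<pi>) = (\<lambda>b. if b then 3 * n + 1 else 3 * n)"
  "label (dnf_bp n \<pi>) u = (let i = u div 3 + 1 in
     if u mod 3 = 0 then ZVar i else if u mod 3 = 1 then XVar (\<pi> i) else YVar i)"
  "succ (dnf_bp n \<pi>) u b = (if u mod 3 = 0 then (if b then u + 1 else u + 3)
     else if b then 3 * n + 1 else u + 1)"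
  by (simp_all add: dnf_bp_def)

lemma inner_nodes_dnf_bp: "inner_nodes (dnf_bp n \<pi>) = {..<3 * n}"
  by (auto simp: inner_nodes_def dnf_bp_sel image_def split: if_splits)

text \<open>Edges increase node numbers, and every node except 0 has an explicit predecessor, so 0
  is the only source. A label determines the residue of its node modulo 3 by its kind and the
  quotient by its index, through injectivity of \<open>\<pi>\<close>.\<close>

lemma dnf_bp_oabp:
  assumes "n \<ge> 1" "bij_betw \<pi> {1..n} {1..n}"
  shows "is_oabp (gamma_vars n) (dnf_bp n \<pi>)"
proof -
  let ?B = "dnf_bp n \<pi>"
  have edge: "(u, succ ?B u b) \<in> bp_edges ?B" if "u < 3 * n" for u b
    using that by (auto simp: bp_edges_def inner_nodes_dnf_bp)
  have less: "u < v" if "(u, v) \<in> bp_edges ?B" for u v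
    using that by (auto simp: bp_edges_def inner_nodes_dnf_bp) (auto simp: dnf_bp_sel)
  have "bp_edges ?B \<subseteq> less_than" using less by auto
  then have "acyclic (bp_edges ?B)" using acyclic_subset wf_acyclic[OF wf_less_than] by blast
  moreover have "label ?B u \<in> gamma_vars n" if "u < 3 * n" for u
  proof -
    have "u div 3 + 1 \<in> {1..n}" using that by auto
    moreover from this have "\<pi> (u div 3 + 1) \<in> {1..n}" using assms(2) bij_betwE by blast
    ultimately show ?thesis by (auto simp: dnf_bp_sel gamma_vars_def Let_def)
  qed
  moreover have "succ ?B u b \<in> nodes ?B" if "u < 3 * n" for u b
    using that by (auto simp: dnf_bp_sel)
  moreover have "{v \<in> nodes ?B. \<forall>u. (u, v) \<notin> bp_edges ?B} = {source ?B}"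
  proof -
    have "\<exists>u. (u, v) \<in> bp_edges ?B" if "v < 3 * n + 2" "v \<noteq> 0" for v
    proof -
      have "v mod 3 = 0 \<or> v mod 3 = 1 \<or> v mod 3 = 2" by presburger
      moreover have "v = 3 * n + 1 \<or> v \<le> 3 * n" using that by linarith
      ultimately consider "v = 3 * n + 1" | "v \<le> 3 * n" "v mod 3 = 0" | "v \<le> 3 * n" "v mod 3 = 1"
        | "v \<le> 3 * n" "v mod 3 = 2" by metis
      then show ?thesis
      proof cases
        case 1
        then show ?thesis using edge[of 1 True] assms(1) by (auto simp: dnf_bp_sel)
      next
        case 2
        then obtain q where "v = 3 * q" by auto
        with that 2 obtain q' where "v = 3 * q' + 3" by (cases q) auto
        then show ?thesis using edge[of "3 * q'" False] 2 by (auto simp: dnf_bp_sel)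
      next
        case 3
        then obtain q where "v = 3 * q + 1" by (metis mult_div_mod_eq)
        then show ?thesis using edge[of "3 * q" True] 3 by (auto simp: dnf_bp_sel)
      next
        case 4
        then obtain q where q: "v = 3 * q + 2" by (metis mult_div_mod_eq)
        then have "(3 * q + 1) mod 3 = 1" by presburger
        then show ?thesis using edge[of "3 * q + 1" False] 4 q by (auto simp: dnf_bp_sel)
      qed
    qed
    then show ?thesis using less by (fastforce simp: dnf_bp_sel)
  qed
  moreover have "inj_on (label ?B) {..<3 * n}"
  proof (rule inj_onI)
    fix u v assume uv: "u \<in> {..<3 * n}" "v \<in> {..<3 * n}" "label ?B u = label ?B v"
    have "u div 3 + 1 \<in> {1..n}" "v div 3 + 1 \<in> {1..n}" using uv by auto
    moreover have "inj_on \<pi> {1..n}" using assms(2) by (simp add: bij_betw_def)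
    ultimately have "\<pi> (u div 3 + 1) = \<pi> (v div 3 + 1) \<longleftrightarrow> u div 3 + 1 = v div 3 + 1"
      by (simp only: inj_on_eq_iff)
    then have "u div 3 = v div 3"
      using uv(3) unfolding dnf_bp_sel Let_def by (simp split: if_split_asm)
    moreover have "u mod 3 = v mod 3"
    proof -
      have "w mod 3 = 0 \<or> w mod 3 = 1 \<or> w mod 3 = 2" for w :: nat by presburger
      from this[of u] this[of v] show ?thesis
        using uv(3) unfolding dnf_bp_sel Let_def by (simp split: if_split_asm)
    qed
    ultimately show "u = v" by (metis mult_div_mod_eq)
  qed
  ultimately show ?thesis
    unfolding is_oabp_def is_bp_def inner_nodes_dnf_bp by (auto simp: dnf_bp_sel)
qed

text \<open>Downward induction from \<open>m = n\<close>, where the disjunction is empty and node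
  \<open>3 * n\<close> is the sink 0.\<close>

lemma dnf_bp_run:
  assumes "m \<le> n"
  shows "(3 * m, sink (dnf_bp n \<pi>) (\<exists>i\<in>{m + 1..n}. a (ZVar i) \<and> (a (XVar (\<pi> i)) \<or> a (YVar i))))
    \<in> (bp_step (dnf_bp n \<pi>) a)\<^sup>*"
  using assms
proof (induction rule: inc_induct)
  case base
  then show ?case by (simp add: dnf_bp_sel)
next
  case (step m)
  let ?B = "dnf_bp n \<pi>" and ?F = "\<lambda>i. a (ZVar i) \<and> (a (XVar (\<pi> i)) \<or> a (YVar i))"
  have st: "(u, succ ?B u (a (label ?B u))) \<in> bp_step ?B a" if "u < 3 * n" for u
    using that by (auto simp: bp_step_def inner_nodes_dnf_bp)
  have m: "3 * m < 3 * n" "3 * m + 1 < 3 * n" "3 * m + 2 < 3 * n" using step by auto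
  have md: "(3 * m + 1) mod 3 = 1" "(3 * m + 2) mod 3 = 2" "(3 * m + 1) div 3 = m" "(3 * m + 2) div 3 = m"
    "3 * (m + 1) = 3 * m + 2 + 1"
    by presburger+
  have z: "(3 * m, if a (ZVar (m + 1)) then 3 * m + 1 else 3 * (m + 1)) \<in> bp_step ?B a"
    using st[OF m(1)] by (cases "a (ZVar (m + 1))") (simp_all add: dnf_bp_sel Let_def add.commute)
  have x: "(3 * m + 1, if a (XVar (\<pi> (m + 1))) then sink ?B True else 3 * m + 2) \<in> bp_step ?B a"
    using st[OF m(2)] md by (cases "a (XVar (\<pi> (m + 1)))") (simp_all add: dnf_bp_sel Let_def add.commute)
  have y: "(3 * m + 2, if a (YVar (m + 1)) then sink ?B True else 3 * (m + 1)) \<in> bp_step ?B a"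
    using st[OF m(3)] md unfolding md(5) by (cases "a (YVar (m + 1))") (simp_all add: dnf_bp_sel Let_def add.commute)
  have range: "{m + 1..n} = insert (m + 1) {m + 2..n}" using step by auto
  show ?case
  proof (cases "?F (m + 1)")
    case True
    then have "(3 * m, sink ?B True) \<in> (bp_step ?B a)\<^sup>*"
      using z x y by (auto split: if_splits intro: converse_rtrancl_into_rtrancl)
    then show ?thesis using True range by simp
  next
    case False
    then have "(3 * m, 3 * (m + 1)) \<in> (bp_step ?B a)\<^sup>*"
      using z x y by (auto split: if_splits intro: converse_rtrancl_into_rtrancl)
    then show ?thesis using step.IH False range by (auto intro: rtrancl_trans)
  qed
qed

text \<open>Clauses (1) to (4) need only that \<open>\<pi>\<close> is a permutation, (5) and (6)
  that it respects the halves, and (7) that its graph is independent.\<close>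

lemma gamma_fun_dnf:
  assumes n: "even n" "n \<ge> 4" and \<pi>: "bij_betw \<pi> {1..n} {1..n}"
    and J: "\<And>i. i \<in> {1..n} \<Longrightarrow> (i, \<pi> i) \<in> J1 n \<union> J2 n"
    and indep: "\<And>i j. i \<in> {1..n} \<Longrightarrow> j \<in> {1..n} \<Longrightarrow> {(i, \<pi> i), (j, \<pi> j)} \<notin> E"
    and some: "gamma_fun n E a = Some b"
  shows "b \<longleftrightarrow> (\<exists>i\<in>{1..n}. a (ZVar i) \<and> (a (XVar (\<pi> i)) \<or> a (YVar i)))"
proof -
  define h where "h = n div 2"
  have nh: "n = 2 * h" using n by (auto simp: h_def)
  have sub: "{1..h} \<subseteq> {1..n}" "{h + 1..n} \<subseteq> {1..n}" using nh by auto
  have img: "\<pi> ` {1..n} = {1..n}" using \<pi> by (simp add: bij_betw_def)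
  have half: "\<pi> i \<in> {1..h} \<longleftrightarrow> i \<in> {1..h}" "\<pi> i \<in> {h + 1..n} \<longleftrightarrow> i \<in> {h + 1..n}"
    if "i \<in> {1..n}" for i
    using J[OF that] by (auto simp: J1_def J2_def h_def)
  have ex: "(\<exists>k\<in>{1..n}. Q (\<pi> k)) \<longleftrightarrow> (\<exists>k\<in>{1..n}. Q k)" for Q
    using img by (metis (no_types, lifting) bex_imageD image_eqI)
  have exl: "(\<exists>k\<in>{1..h}. Q (\<pi> k)) \<longleftrightarrow> (\<exists>k\<in>{1..h}. Q k)" for Q
    using ex[of "\<lambda>k. k \<in> {1..h} \<and> Q k"] half(1) sub(1) by blast
  have exu: "(\<exists>k\<in>{h + 1..n}. Q (\<pi> k)) \<longleftrightarrow> (\<exists>k\<in>{h + 1..n}. Q k)" for Q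
    using ex[of "\<lambda>k. k \<in> {h + 1..n} \<and> Q k"] half(2) sub(2) by blast
  let ?x = "\<lambda>i. a (XVar i)" and ?y = "\<lambda>i. a (YVar i)" and ?z = "\<lambda>i. a (ZVar i)"
  define edge_input where "edge_input \<longleftrightarrow> (\<exists>j\<in>{1..h}. \<exists>k\<in>{1..h}. \<exists>j'\<in>{1..h}. \<exists>k'\<in>{1..h}.
    {(j, k), (h + j', h + k')} \<in> E \<and>
    vec_eq n ?x (concat_vec h (compl_vec (unit_vec k)) (compl_vec (unit_vec k'))) \<and>
    vec_eq n ?y (const_vec False) \<and>
    vec_eq n ?z (concat_vec h (unit_vec j) (unit_vec j')))"
  \<comment> \<open>Precedence among the clauses is dropped: the formula agrees with each clause on
    its whole domain.\<close>
  consider (x0) "vec_eq n ?x (const_vec False)" "b \<longleftrightarrow> (\<exists>i\<in>{1..n}. ?y i \<and> ?z i)"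
    | (x1) "vec_eq n ?x (const_vec True)" "b \<longleftrightarrow> (\<exists>i\<in>{1..n}. ?z i)"
    | (z1) "vec_eq n ?z (const_vec True)" "b \<longleftrightarrow> (\<exists>i\<in>{1..n}. ?x i \<or> ?y i)"
    | (z0) "vec_eq n ?z (const_vec False)" "\<not> b"
    | (lower) "vec_eq n ?z (concat_vec h (const_vec True) (const_vec False))"
        "vec_eq n ?y (const_vec False)" "b \<longleftrightarrow> (\<exists>i\<in>{1..h}. ?x i)"
    | (upper) "vec_eq n ?z (concat_vec h (const_vec False) (const_vec True))"
        "vec_eq n ?y (const_vec False)" "b \<longleftrightarrow> (\<exists>i\<in>{h + 1..n}. ?x i)"
    | (edge) edge_input b
    using some unfolding gamma_fun_def gamma_def Let_def h_def[symmetric] edge_input_def[symmetric]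
    by (auto simp only: option.inject option.distinct split: if_split_asm)
  then show ?thesis
  proof cases
    case x0
    then show ?thesis using img by (auto simp: vec_eq_def const_vec_def simp del: atLeastAtMost_iff)
  next
    case x1
    then show ?thesis using img by (auto simp: vec_eq_def const_vec_def simp del: atLeastAtMost_iff)
  next
    case z1
    then show ?thesis using ex[of ?x]
      by (auto simp: vec_eq_def const_vec_def simp del: atLeastAtMost_iff)
  next
    case z0
    then show ?thesis by (auto simp: vec_eq_def const_vec_def)
  next
    case lower
    have "?z i \<longleftrightarrow> i \<in> {1..h}" "\<not> ?y i" if "i \<in> {1..n}" for i
      using lower(1,2) that by (auto simp: vec_eq_def const_vec_def concat_vec_def)
    then show ?thesis using lower(3) exl[of ?x] nh by fastforce
  next
    case upper
    have "?z i \<longleftrightarrow> i \<in> {h + 1..n}" "\<not> ?y i" if "i \<in> {1..n}" for i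
      using upper(1,2) that by (auto simp: vec_eq_def const_vec_def concat_vec_def)
    then show ?thesis using upper(3) exu[of ?x] nh by fastforce
  next
    case edge
    then obtain j k j' k' where jk: "j \<in> {1..h}" "k \<in> {1..h}" "j' \<in> {1..h}" "k' \<in> {1..h}"
        "{(j, k), (h + j', h + k')} \<in> E"
        "vec_eq n ?x (concat_vec h (compl_vec (unit_vec k)) (compl_vec (unit_vec k')))"
        "vec_eq n ?z (concat_vec h (unit_vec j) (unit_vec j'))"
      unfolding edge_input_def by blast
    have x: "?x i \<longleftrightarrow> i \<noteq> k \<and> i \<noteq> h + k'" and z: "?z i \<longleftrightarrow> i = j \<or> i = h + j'"
      if "i \<in> {1..n}" for i
      using jk(1-4,6,7) that by (auto simp: vec_eq_def concat_vec_def compl_vec_def unit_vec_def)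
    have jn: "j \<in> {1..n}" "h + j' \<in> {1..n}" using jk(1,3) nh by auto
    then have "\<pi> j \<in> {1..h}" "\<pi> (h + j') \<in> {h + 1..n}" using half[of j] half[of "h + j'"] jk(1,3) by auto
    \<comment> \<open>The formula asks for \<open>x\<close> to be 1 at \<open>\<pi> j\<close> or
      \<open>\<pi> (h + j')\<close>; it fails only if these are the two zeros of \<open>x\<close>,
      which would put both ends of the edge on the graph of \<open>\<pi>\<close>.\<close>
    moreover have "\<not> (\<pi> j = k \<and> \<pi> (h + j') = h + k')" using indep[OF jn] jk(5) by auto
    ultimately have "?x (\<pi> j) \<or> ?x (\<pi> (h + j'))" using x[of "\<pi> j"] x[of "\<pi> (h + j')"] jk(2,4) nh by auto
    then show ?thesis using z jn edge(2) by blast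
  qed
qed

theorem theorem6:
  fixes n :: nat and E :: "(nat \<times> nat) set set"
  assumes "even n" and "n \<ge> 4" and "bpis_graph n E"
  shows "bpis_yes n E \<longleftrightarrow>
    (\<exists>B. is_oabp (gamma_vars n) B \<and> bp_computes B (gamma_fun n E))"
proof
  assume "bpis_yes n E"
  then obtain S where S: "S \<subseteq> J1 n \<union> J2 n" "independent_set E S" "card S = n"
    and rows: "\<And>i. i \<in> {1..n} \<Longrightarrow> \<exists>j. (i, j) \<in> S" and cols: "\<And>i. i \<in> {1..n} \<Longrightarrow> \<exists>k. (k, i) \<in> S"
    unfolding bpis_yes_def by blast
  have "S \<subseteq> {1..n} \<times> {1..n}" 
  proof -
    have "J1 n \<union> J2 n \<subseteq> {1..n} \<times> {1..n}" by (auto simp: J1_def J2_def)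
    then show ?thesis using S(1) by blast
  qed
  then have "fst ` S \<subseteq> {1..n}" "snd ` S \<subseteq> {1..n}" by (auto simp del: atLeastAtMost_iff)
  moreover have "{1..n} \<subseteq> fst ` S" "{1..n} \<subseteq> snd ` S"
    using rows cols by (metis fst_conv image_eqI subsetI, metis snd_conv image_eqI subsetI)
  ultimately have coords: "fst ` S = {1..n}" "snd ` S = {1..n}" by blast+
  \<comment> \<open>An infinite set has \<open>card\<close> 0, whereas \<open>card S = n\<close> is
    positive.\<close>
  then have fin: "finite S" using S(3) assms(2) by (intro card_ge_0_finite) simp
  \<comment> \<open>Both projections map the \<open>n\<close> elements of \<open>S\<close> onto
    \<open>n\<close> values, so \<open>S\<close> is the graph of a permutation.\<close>
  have "inj_on fst S" "inj_on snd S"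
    using coords S(3) fin by (auto intro!: eq_card_imp_inj_on)
  then have bij: "bij_betw fst S {1..n}" "bij_betw snd S {1..n}"
    using coords by (auto simp: bij_betw_def)
  define \<pi> where "\<pi> = snd \<circ> inv_into S fst"
  have \<pi>: "bij_betw \<pi> {1..n} {1..n}"
    unfolding \<pi>_def using bij bij_betw_trans bij_betw_inv_into by blast
  have mem: "(i, \<pi> i) \<in> S" if "i \<in> {1..n}" for i
  proof -
    have i: "i \<in> fst ` S" using coords that by simp
    have "inv_into S fst i = (i, \<pi> i)" using f_inv_into_f[OF i] by (simp add: \<pi>_def prod_eq_iff)
    then show ?thesis using inv_into_into[OF i] by simp
  qed
  have "bp_computes (dnf_bp n \<pi>) (gamma_fun n E)"
    unfolding bp_computes_def bp_outputs_def
  proof (intro allI impI)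
    fix a b assume "gamma_fun n E a = Some b"
    then have "b \<longleftrightarrow> (\<exists>i\<in>{1..n}. a (ZVar i) \<and> (a (XVar (\<pi> i)) \<or> a (YVar i)))"
      using mem S(1,2) by (intro gamma_fun_dnf[OF assms(1,2) \<pi>]) (auto simp: independent_set_def)
    then show "(source (dnf_bp n \<pi>), sink (dnf_bp n \<pi>) b) \<in> (bp_step (dnf_bp n \<pi>) a)\<^sup>*"
      using dnf_bp_run[of 0 n \<pi> a] by (simp add: dnf_bp_sel)
  qed
  moreover have "is_oabp (gamma_vars n) (dnf_bp n \<pi>)"
    using assms(2) \<pi> by (intro dnf_bp_oabp) auto
  ultimately show "\<exists>B. is_oabp (gamma_vars n) B \<and> bp_computes B (gamma_fun n E)" by blast
next
  assume "\<exists>B. is_oabp (gamma_vars n) B \<and> bp_computes B (gamma_fun n E)"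
  then show "bpis_yes n E" using bpis_yes_if_oabp[OF assms] by blast
qed

end
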